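(* Let $n\ge 2$ and let $\mathfrak{heis}_b=E^*+E+\mathbb{R}\mathrm{p}$ be the Heisenberg algebra, $\dim E=n-1$. Every suitable pair $$(\rho_{11},\rho_{12})\in \mathrm{Hom}_{\mathbb R}(E,\mathcal C_{0,n-1})\oplus \mathrm{Hom}_{\mathbb R}(E,\mathrm{End}_{\mathbb R}(S_{0,n-1}))$$ defines a zero charge spin representation $\rho:\mathfrak{heis}_b\to\mathfrak{gl}_{\mathbb R}(S)$ given by $$\rho(e^\flat)=\begin{pmatrix}0&\sqrt2\,Be\\0&0\end{pmatrix},\qquad \rho(\mathrm p)=\begin{pmatrix}0&0\\0&0\end{pmatrix},\qquad \rho(e)=\begin{pmatrix}\rho_{11}(e)&\rho_{12}(e)\\0&\overline{\rho_{11}}(e)\end{pmatrix}\qquad(e\in E).$$ Moreover, every zero charge spin representation of $\mathfrak{heis}_b$ is of this type.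
   Context: $E=\mathbb R^{0,n-1}$ is an $(n-1)$-dimensional real vector space with a negative definite inner product $\langle\cdot,\cdot\rangle$; $e^\flat=\langle e,\cdot\rangle\in E^*$. $b$ is a non-degenerate symmetric bilinear form on $E$ and $B\in\mathrm{End}_{\mathbb R}(E)$ is defined by $b(\cdot,\cdot)=-\langle B\cdot,\cdot\rangle$. The Heisenberg algebra $\mathfrak{heis}_b=E^*+E+\mathbb R\mathrm p$ has as only non-trivial brackets $[e^\flat,f]=b(e,f)\mathrm p$ ($e,f\in E$). $\mathrm{Cl}_{0,n-1}$ is the Clifford algebra of $E$ with convention $v^2=-\langle v,v\rangle$ (so unit vectors of $E$ square to $+1$), $S_{0,n-1}$ is a real irreducible $\mathrm{Cl}_{0,n-1}$-module, and vectors of $E$ act on it by Clifford multiplication. $\mathfrak{so}(E)\hookrightarrow \mathrm{Cl}_{0,n-1}$ via $v\wedge w\mapsto\frac14[v,w]$. The Schur algebra is $\mathcal C_{0,n-1}=\mathrm{End}_{\mathbb R}(S_{0,n-1})^{\mathfrak{so}(E)}$. It is the direct sum of the subspaces of elements $C$ commuting with Clifford multiplication by all vectors ($\tau(C)=+1$) and anticommuting with Clifford multiplication by all vectors ($\tau(C)=-1$); $C\mapsto\overline C$ is the linear map with $\overline C=\tau(C)C$ on these subspaces, and $\overline{\rho_{11}}(e):=\overline{\rho_{11}(e)}$. Let $\mathfrak m=E+\mathbb R\mathrm p+\mathbb R\mathrm q$ be Minkowski space ($\mathrm p,\mathrm q$ isotropic, orthogonal to $E$, $\langle\mathrm p,\mathrm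 q\rangle=1$) and $S=S_{1,n}$ the real irreducible $\mathrm{Cl}(\mathfrak m)$-module. It is identified, as a vector space, with $S=S_-+S_+=S_{0,n-1}+S_{0,n-1}$ (endomorphisms written as $2\times2$ block matrices) in such a way that $\mathrm p\wedge e\in\mathfrak{so}(\mathfrak m)$ acts as $\begin{pmatrix}0&\sqrt2\,e\\0&0\end{pmatrix}$. A Lie algebra representation $\rho:\mathfrak{heis}_b\to\mathfrak{gl}_{\mathbb R}(S)$ is called spin if $\rho(e^\flat)$ is the spin action of $\mathrm p\wedge Be$, i.e. $\rho(e^\flat)=\begin{pmatrix}0&\sqrt2\,Be\\0&0\end{pmatrix}$ for all $e\in E$. It has zero charge if $\rho(\mathrm p)=0$. A pair $(\rho_{11},\rho_{12})\in \mathrm{Hom}_{\mathbb R}(E,\mathcal C_{0,n-1})\oplus \mathrm{Hom}_{\mathbb R}(E,\mathrm{End}_{\mathbb R}(S_{0,n-1}))$ is called suitable if $[\rho_{11}(E),\rho_{11}(E)]=0$ and the bilinear map $E\otimes E\to\mathrm{End}_{\mathbb R}(S_{0,n-1})$, $e\otimes f\mapsto\rho_{11}(e)\circ\rho_{12}(f)-\rho_{12}(f)\circ\overline{\rho_{11}}(e)$, is symmetric. *)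

theory Defs
  imports "HOL-Analysis.Analysis"
begin

text \<open>
  All vector spaces are finite-dimensional, so bounded linear maps are exactly the linear maps:
  \<open>'s \<Rightarrow>\<^sub>L 's\<close> is the algebra of all real endomorphisms of \<open>'s\<close>, with product \<open>o\<^sub>L\<close>, and
  \<open>'e \<Rightarrow>\<^sub>L real\<close> is the full dual space. The norms that these types carry play no role, and the
  inner product on spinor spaces supplied by the class \<open>euclidean_space\<close> is not used either.
\<close>

definition comm :: "('s::real_normed_vector \<Rightarrow>\<^sub>L 's) \<Rightarrow> ('s \<Rightarrow>\<^sub>L 's) \<Rightarrow> ('s \<Rightarrow>\<^sub>L 's)"
  where "comm X Y = (X o\<^sub>L Y) - (Y o\<^sub>L X)"

definition block ::
  "('s::euclidean_space \<Rightarrow>\<^sub>L 's) \<Rightarrow> ('s \<Rightarrow>\<^sub>L 's) \<Rightarrow> ('s \<Rightarrow>\<^sub>L 's) \<Rightarrow> ('s \<Rightarrow>\<^sub>L 's) \<Rightarrow> (('s \<times> 's) \<Rightarrow>\<^sub>L ('s \<times> 's))"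
  where "block P Q R T = Blinfun (\<lambda>(x, y). (P x + Q y, R x + T y))"

lemma block_apply: "blinfun_apply (block P Q R T) (x, y) = (P x + Q y, R x + T y)"
proof -
  have "linear (\<lambda>(x, y). (P x + Q y, R x + T y))"
    by (rule linearI) (auto simp: blinfun.bilinear_simps algebra_simps)
  then have "bounded_linear (\<lambda>(x, y). (P x + Q y, R x + T y))"
    by (rule linear_linear[THEN iffD2])
  then show ?thesis
    by (simp add: block_def bounded_linear_Blinfun_apply)
qed


section \<open>The negative definite space and the Minkowski space\<close>

text \<open>
  \<open>'e::euclidean_space\<close>, equipped with minus its Euclidean inner product, is
  the space of signature (0, n - 1), where \<open>n - 1 = DIM('e)\<close>.
\<close>

definition ip :: "'e::euclidean_space \<Rightarrow> 'e \<Rightarrow> real"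
  where "ip e f = - (e \<bullet> f)"

text \<open>\<open>(e, s, t)\<close> stands for \<open>e + s p + t q\<close> in \<open>E + \<real> p + \<real> q\<close>.\<close>

definition mink_ip :: "'e::euclidean_space \<times> real \<times> real \<Rightarrow> 'e \<times> real \<times> real \<Rightarrow> real"
  where "mink_ip = (\<lambda>(e, s, t) (e', s', t'). ip e e' + s * t' + t * s')"

definition mink_E :: "'e::euclidean_space \<Rightarrow> 'e \<times> real \<times> real"
  where "mink_E e = (e, 0, 0)"

definition mink_p :: "'e::euclidean_space \<times> real \<times> real"
  where "mink_p = (0, 1, 0)"


section \<open>Clifford modules\<close>

text \<open>
  A module of the Clifford algebra of \<open>(V, g)\<close>, with the sign convention \<open>v\<^sup>2 = - g v v\<close>, is given
  by its Clifford multiplication \<open>c\<close> by vectors: the Clifford algebra is generated by \<open>V\<close> subject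
  to these relations (and linearity), and so the submodules are the subspaces invariant under
  Clifford multiplication by all vectors. A simple module has to be nonzero, which holds for every
  type of class \<open>euclidean_space\<close>.
\<close>

definition clifford_module ::
  "('v::real_vector \<Rightarrow> 'v \<Rightarrow> real) \<Rightarrow> ('v \<Rightarrow> ('s::euclidean_space \<Rightarrow>\<^sub>L 's)) \<Rightarrow> bool"
  where "clifford_module g c \<longleftrightarrow> linear c \<and> (\<forall>v. c v o\<^sub>L c v = (- g v v) *\<^sub>R id_blinfun)"

definition irreducible_clifford_module ::
  "('v::real_vector \<Rightarrow> 'v \<Rightarrow> real) \<Rightarrow> ('v \<Rightarrow> ('s::euclidean_space \<Rightarrow>\<^sub>L 's)) \<Rightarrow> bool"
  where "irreducible_clifford_module g c \<longleftrightarrow> clifford_module g c \<and>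
    (\<forall>W. subspace W \<and> (\<forall>v. \<forall>x\<in>W. blinfun_apply (c v) x \<in> W) \<longrightarrow> W = {0} \<or> W = UNIV)"

text \<open>The action of \<open>v \<and> w\<close> in \<open>so(V)\<close> on a Clifford module.\<close>

definition spin_action ::
  "('v \<Rightarrow> ('s::euclidean_space \<Rightarrow>\<^sub>L 's)) \<Rightarrow> 'v \<Rightarrow> 'v \<Rightarrow> ('s \<Rightarrow>\<^sub>L 's)"
  where "spin_action c v w = (1 / 4) *\<^sub>R comm (c v) (c w)"

text \<open>The elements \<open>v \<and> w\<close> span \<open>so(V)\<close>, so it suffices to commute with these.\<close>

definition schur_algebra :: "('v \<Rightarrow> ('s::euclidean_space \<Rightarrow>\<^sub>L 's)) \<Rightarrow> ('s \<Rightarrow>\<^sub>L 's) set"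
  where "schur_algebra c = {C. \<forall>v w. comm C (spin_action c v w) = 0}"

definition schur_plus :: "('v \<Rightarrow> ('s::euclidean_space \<Rightarrow>\<^sub>L 's)) \<Rightarrow> ('s \<Rightarrow>\<^sub>L 's) set"
  where "schur_plus c = {C \<in> schur_algebra c. \<forall>v. C o\<^sub>L c v = c v o\<^sub>L C}"

definition schur_minus :: "('v \<Rightarrow> ('s::euclidean_space \<Rightarrow>\<^sub>L 's)) \<Rightarrow> ('s \<Rightarrow>\<^sub>L 's) set"
  where "schur_minus c = {C \<in> schur_algebra c. \<forall>v. C o\<^sub>L c v = - (c v o\<^sub>L C)}"

text \<open>
  Meaningful only for \<open>C\<close> in the Schur algebra; \<open>schur_decomposition\<close> and \<open>schur_bar_eq\<close> below
  show that the description determines \<open>schur_bar c C\<close> there.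
\<close>

definition schur_bar :: "('v \<Rightarrow> ('s::euclidean_space \<Rightarrow>\<^sub>L 's)) \<Rightarrow> ('s \<Rightarrow>\<^sub>L 's) \<Rightarrow> ('s \<Rightarrow>\<^sub>L 's)"
  where "schur_bar c C =
    (THE D. \<exists>P\<in>schur_plus c. \<exists>M\<in>schur_minus c. C = P + M \<and> D = P - M)"

lemma schur_bar_eq:
  fixes c :: "'e::euclidean_space \<Rightarrow> ('s::euclidean_space \<Rightarrow>\<^sub>L 's)"
  assumes c: "clifford_module ip c" and P: "P \<in> schur_plus c" and M: "M \<in> schur_minus c"
  shows "schur_bar c (P + M) = P - M"
proof -
  obtain u :: 'e where u: "u \<in> Basis"
    using nonempty_Basis by blast
  have sq: "c u o\<^sub>L c u = id_blinfun"
    using c u by (simp add: clifford_module_def ip_def)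
  have conj: "c u o\<^sub>L (P' + M') o\<^sub>L c u = P' - M'"
    if "P' \<in> schur_plus c" "M' \<in> schur_minus c" for P' M'
  proof (rule blinfun_eqI)
    fix x
    have sq': "c u (c u y) = y" for y
      using arg_cong[OF sq, of "\<lambda>F. blinfun_apply F y"] by simp
    have "P' o\<^sub>L c u = c u o\<^sub>L P'" "M' o\<^sub>L c u = - (c u o\<^sub>L M')"
      using that by (auto simp: schur_plus_def schur_minus_def)
    then have "P' (c u x) = c u (P' x)" "M' (c u x) = - c u (M' x)"
      by (metis blinfun_apply_blinfun_compose, metis blinfun_apply_blinfun_compose uminus_blinfun.rep_eq)
    then show "(c u o\<^sub>L (P' + M') o\<^sub>L c u) x = (P' - M') x"
      by (simp add: blinfun.bilinear_simps sq')
  qed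
  show ?thesis
    unfolding schur_bar_def
  proof (rule the_equality)
    show "\<exists>P'\<in>schur_plus c. \<exists>M'\<in>schur_minus c. P + M = P' + M' \<and> P - M = P' - M'"
      using P M by blast
  next
    fix D assume "\<exists>P'\<in>schur_plus c. \<exists>M'\<in>schur_minus c. P + M = P' + M' \<and> D = P' - M'"
    then show "D = P - M"
      using conj P M by metis
  qed
qed

lemma schur_decomposition:
  fixes c :: "'e::euclidean_space \<Rightarrow> ('s::euclidean_space \<Rightarrow>\<^sub>L 's)"
  assumes c: "clifford_module ip c" and C: "C \<in> schur_algebra c"
  shows "\<exists>P\<in>schur_plus c. \<exists>M\<in>schur_minus c. C = P + M"
proof -
  obtain u :: 'e where u: "u \<in> Basis"
    using nonempty_Basis by blast
  have lin: "linear c" and rel: "\<And>v. c v o\<^sub>L c v = (v \<bullet> v) *\<^sub>R id_blinfun"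
    using c by (auto simp: clifford_module_def ip_def)
  have rel': "c v (c v x) = (v \<bullet> v) *\<^sub>R x" for v x
    using arg_cong[OF rel[of v], of "\<lambda>F. blinfun_apply F x"] by (simp add: blinfun.scaleR_left)
  have sq: "c u (c u x) = x" for x
    using rel'[of u x] u by simp
  have acomm: "c w (c v x) = (2 * (v \<bullet> w)) *\<^sub>R x - c v (c w x)" for v w x
    using rel'[of "v + w" x]
    by (simp add: linear_add[OF lin] blinfun.bilinear_simps rel' inner_add inner_commute algebra_simps
        flip: scaleR_2)
  have even: "C (c v (c w x)) = c v (c w (C x))" for v w x
  proof -
    have "comm C (spin_action c v w) = 0"
      using C by (simp add: schur_algebra_def)
    moreover have "comm C (spin_action c v w) = (1 / 4) *\<^sub>R comm C (comm (c v) (c w))"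
      by (rule blinfun_eqI) (simp add: comm_def spin_action_def blinfun.bilinear_simps algebra_simps)
    ultimately have "blinfun_apply (comm C (comm (c v) (c w))) x = 0"
      by simp
    then have "C (c v (c w x) - c w (c v x)) = c v (c w (C x)) - c w (c v (C x))"
      by (simp add: comm_def blinfun.bilinear_simps algebra_simps)
    then have "2 *\<^sub>R C (c v (c w x)) = 2 *\<^sub>R c v (c w (C x))"
      by (simp add: acomm[of w v] blinfun.bilinear_simps algebra_simps scaleR_2)
    then show ?thesis by simp
  qed
  define D where "D = c u o\<^sub>L C o\<^sub>L c u"
  have D: "D (c v x) = c v (C x)" "c v (D x) = C (c v x)" for v x
  proof -
    show "D (c v x) = c v (C x)"
      by (simp add: D_def even sq)
    show "c v (D x) = C (c v x)"
      using even[of v u "c u x"] by (simp add: D_def sq)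
  qed
  have inS: "D \<in> schur_algebra c"
    by (auto simp: schur_algebra_def comm_def spin_action_def blinfun.bilinear_simps D
        intro!: blinfun_eqI)
  have mem: "(1/2) *\<^sub>R (C + s *\<^sub>R D) \<in> schur_algebra c" for s
  proof -
    have "comm ((1/2) *\<^sub>R (C + s *\<^sub>R D)) X = (1/2) *\<^sub>R (comm C X + s *\<^sub>R comm D X)" for X
      by (rule blinfun_eqI) (simp add: comm_def blinfun.bilinear_simps algebra_simps)
    then show ?thesis
      using C inS by (simp add: schur_algebra_def)
  qed
  have "(1/2) *\<^sub>R (C + D) \<in> schur_plus c"
    using mem[of 1]
    by (auto simp: schur_plus_def blinfun.bilinear_simps D algebra_simps intro!: blinfun_eqI)
  moreover have "(1/2) *\<^sub>R (C - D) \<in> schur_minus c"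
    using mem[of "-1"]
    by (auto simp: schur_minus_def blinfun.bilinear_simps D algebra_simps intro!: blinfun_eqI)
  moreover have "C = (1/2) *\<^sub>R (C + D) + (1/2) *\<^sub>R (C - D)"
    by (simp add: algebra_simps flip: scaleR_add_left)
  ultimately show ?thesis by blast
qed

section \<open>The Heisenberg algebra\<close>

definition flat :: "'e::euclidean_space \<Rightarrow> ('e \<Rightarrow>\<^sub>L real)"
  where "flat e = Blinfun (\<lambda>f. ip e f)"

definition sharp :: "('e::euclidean_space \<Rightarrow>\<^sub>L real) \<Rightarrow> 'e"
  where "sharp \<alpha> = (THE e. flat e = \<alpha>)"

lemma flat_apply: "blinfun_apply (flat e) f = ip e f"
proof -
  have "bounded_linear (\<lambda>f. ip e f)"
    unfolding ip_def by (intro bounded_linear_minus bounded_linear_inner_right)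
  then show ?thesis
    by (simp add: flat_def bounded_linear_Blinfun_apply)
qed

lemma flat_inject: "flat e = flat f \<longleftrightarrow> e = f"
proof
  assume "flat e = flat f"
  then have "ip e x = ip f x" for x
    by (metis flat_apply)
  then have "\<forall>x. e \<bullet> x = f \<bullet> x"
    by (simp add: ip_def)
  then show "e = f"
    by (simp only: vector_eq_rdot)
qed simp

lemma sharp_flat: "sharp (flat e) = e"
  by (simp add: sharp_def flat_inject)

text \<open>\<open>(\<alpha>, e, t)\<close> stands for \<open>\<alpha> + e + t p\<close> in \<open>E\<^sup>* + E + \<real> p\<close>.\<close>

type_synonym 'e heis = "('e \<Rightarrow>\<^sub>L real) \<times> 'e \<times> real"

definition heis_bracket ::
  "('e::euclidean_space \<Rightarrow> 'e \<Rightarrow> real) \<Rightarrow> 'e heis \<Rightarrow> 'e heis \<Rightarrow> 'e heis"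
  where "heis_bracket b =
    (\<lambda>(\<alpha>, e, s) (\<beta>, f, t). (0, 0, b (sharp \<alpha>) f - b (sharp \<beta>) e))"

definition heis_flat :: "'e::euclidean_space \<Rightarrow> 'e heis"
  where "heis_flat e = (flat e, 0, 0)"

definition heis_E :: "'e::euclidean_space \<Rightarrow> 'e heis"
  where "heis_E e = (0, e, 0)"

definition heis_p :: "'e::euclidean_space heis"
  where "heis_p = (0, 0, 1)"

lemma heis_bracket_flat_E:
  assumes "bilinear b"
  shows "heis_bracket b (heis_flat e) (heis_E f) = b e f *\<^sub>R heis_p"
proof -
  have "flat (0::'a) = 0"
    by (rule blinfun_eqI) (simp add: flat_apply ip_def)
  then have "sharp 0 = (0::'a)"
    by (metis sharp_flat)
  then show ?thesis
    using bilinear_lzero[OF assms]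
    by (simp add: heis_bracket_def heis_flat_def heis_E_def heis_p_def sharp_flat)
qed

definition heis_representation ::
  "('e::euclidean_space \<Rightarrow> 'e \<Rightarrow> real) \<Rightarrow> ('e heis \<Rightarrow> ('t::euclidean_space \<Rightarrow>\<^sub>L 't)) \<Rightarrow> bool"
  where "heis_representation b \<rho> \<longleftrightarrow>
    linear \<rho> \<and> (\<forall>x y. \<rho> (heis_bracket b x y) = comm (\<rho> x) (\<rho> y))"

text \<open>
  \<open>\<Gamma>\<close> is the Clifford multiplication of Minkowski space; \<open>spin_action \<Gamma> mink_p (mink_E (B e))\<close>
  is the action of \<open>p \<and> B e\<close>.
\<close>

definition spin_representation ::
  "('e::euclidean_space \<Rightarrow> 'e \<Rightarrow> real) \<Rightarrow> ('e \<Rightarrow> 'e) \<Rightarrow>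
   ('e \<times> real \<times> real \<Rightarrow> ('t::euclidean_space \<Rightarrow>\<^sub>L 't)) \<Rightarrow> ('e heis \<Rightarrow> ('t \<Rightarrow>\<^sub>L 't)) \<Rightarrow> bool"
  where "spin_representation b B \<Gamma> \<rho> \<longleftrightarrow> heis_representation b \<rho> \<and>
    (\<forall>e. \<rho> (heis_flat e) = spin_action \<Gamma> mink_p (mink_E (B e)))"

definition zero_charge :: "('e::euclidean_space heis \<Rightarrow> ('t::euclidean_space \<Rightarrow>\<^sub>L 't)) \<Rightarrow> bool"
  where "zero_charge \<rho> \<longleftrightarrow> \<rho> heis_p = 0"


section \<open>Suitable pairs\<close>

definition suitable ::
  "('e::euclidean_space \<Rightarrow> ('s::euclidean_space \<Rightarrow>\<^sub>L 's)) \<Rightarrow>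
   ('e \<Rightarrow> ('s \<Rightarrow>\<^sub>L 's)) \<Rightarrow> ('e \<Rightarrow> ('s \<Rightarrow>\<^sub>L 's)) \<Rightarrow> bool"
  where "suitable c \<rho>11 \<rho>12 \<longleftrightarrow>
    linear \<rho>11 \<and> range \<rho>11 \<subseteq> schur_algebra c \<and> linear \<rho>12 \<and>
    (\<forall>e f. comm (\<rho>11 e) (\<rho>11 f) = 0) \<and>
    (\<forall>e f. (\<rho>11 e o\<^sub>L \<rho>12 f) - (\<rho>12 f o\<^sub>L schur_bar c (\<rho>11 e)) =
           (\<rho>11 f o\<^sub>L \<rho>12 e) - (\<rho>12 e o\<^sub>L schur_bar c (\<rho>11 f)))"

text \<open>The linear map on the Heisenberg algebra given by the block matrices of the theorem.\<close>

definition given_by_pair ::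
  "('e::euclidean_space \<Rightarrow> ('s::euclidean_space \<Rightarrow>\<^sub>L 's)) \<Rightarrow> ('e \<Rightarrow> 'e) \<Rightarrow>
   ('e \<Rightarrow> ('s \<Rightarrow>\<^sub>L 's)) \<Rightarrow> ('e \<Rightarrow> ('s \<Rightarrow>\<^sub>L 's)) \<Rightarrow> ('e heis \<Rightarrow> (('s \<times> 's) \<Rightarrow>\<^sub>L ('s \<times> 's))) \<Rightarrow> bool"
  where "given_by_pair c B \<rho>11 \<rho>12 \<rho> \<longleftrightarrow> linear \<rho> \<and>
    (\<forall>e. \<rho> (heis_flat e) = block 0 (sqrt 2 *\<^sub>R c (B e)) 0 0) \<and>
    \<rho> heis_p = block 0 0 0 0 \<and>
    (\<forall>e. \<rho> (heis_E e) = block (\<rho>11 e) (\<rho>12 e) 0 (schur_bar c (\<rho>11 e)))"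

end

theory Submission
  imports Defs
begin

text \<open>
  Everything rests on the intertwining relation \<open>c v T = C c v\<close> for all vectors \<open>v\<close>, where
  \<open>C\<close> and \<open>T\<close> are endomorphisms of a Clifford module. It has a solution \<open>T\<close> only when \<open>C\<close> lies
  in the Schur algebra, and then the solution is exactly the conjugate of \<open>C\<close>
  (\<open>clifford_intertwiner_iff\<close>): one passes \<open>C\<close> through \<open>c v\<close> to get \<open>T\<close> on the other side, and passes
  \<open>T\<close> through \<open>c w\<close> to get \<open>C\<close> back, because \<open>c w\<close> squares to a scalar; so \<open>C\<close> commutes with the
  products \<open>c v c w\<close>.

  On the side of the Heisenberg algebra, zero charge means that all images commute. Commuting a
  strictly upper triangular block \<open>N\<close> with an arbitrary block matrix
  (\<open>strictly_upper_block_commutes_iff\<close>) gives \<open>N R = 0\<close>, \<open>R N = 0\<close> and \<open>N T = P N\<close>. Since \<open>b\<close> is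
  non-degenerate, \<open>B\<close> is onto, so \<open>N\<close> runs through Clifford multiplication by all vectors.
  Invertibility of a unit vector kills the lower left block \<open>R\<close>, and the last equation is the
  intertwining relation: the diagonal blocks are \<open>C\<close> in the Schur algebra and its conjugate.
  Commutation of two such upper triangular matrices is then read off blockwise
  (\<open>upper_triangular_comm\<close>): the upper left block is the commutativity condition of a suitable
  pair, the upper right block is its symmetry condition, and the lower right block follows from the
  upper left one, as conjugation is multiplicative. These steps can be reversed, which gives both
  halves of the theorem.
\<close>

section \<open>Block matrices\<close>

lemmas compose_linear =
  bounded_bilinear.add_left[OF bounded_bilinear_blinfun_compose]
  bounded_bilinear.add_right[OF bounded_bilinear_blinfun_compose]
  bounded_bilinear.diff_right[OF bounded_bilinear_blinfun_compose]
  bounded_bilinear.scaleR_left[OF bounded_bilinear_blinfun_compose]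
  bounded_bilinear.scaleR_right[OF bounded_bilinear_blinfun_compose]

lemma block_eqI:
  fixes P Q R T :: "'s::euclidean_space \<Rightarrow>\<^sub>L 's"
  assumes "\<And>x y. blinfun_apply X (x, y) = (P x + Q y, R x + T y)"
  shows "X = block P Q R T"
  by (rule blinfun_eqI) (auto simp: assms block_apply)

lemma block_eq_iff:
  "block P Q R T = block P' Q' R' T' \<longleftrightarrow> P = P' \<and> Q = Q' \<and> R = R' \<and> T = T'"
proof
  assume eq: "block P Q R T = block P' Q' R' T'"
  have "(P x + Q y, R x + T y) = (P' x + Q' y, R' x + T' y)" for x y
    using arg_cong[OF eq, of "\<lambda>F. blinfun_apply F (x, y)"] by (simp add: block_apply)
  from this[of _ 0] this[of 0] show "P = P' \<and> Q = Q' \<and> R = R' \<and> T = T'"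
    by (auto intro!: blinfun_eqI)
qed simp

lemma block_exhaust:
  fixes X :: "('s::euclidean_space \<times> 's) \<Rightarrow>\<^sub>L ('s \<times> 's)"
  obtains P Q R T where "X = block P Q R T"
proof -
  have bl: "bounded_linear (\<lambda>x. fst (X (x, 0)))" "bounded_linear (\<lambda>x. fst (X (0, x)))"
    "bounded_linear (\<lambda>x. snd (X (x, 0)))" "bounded_linear (\<lambda>x. snd (X (0, x)))"
    by (auto intro!: bounded_linear_intros)
  have "X = block (Blinfun (\<lambda>x. fst (X (x, 0)))) (Blinfun (\<lambda>x. fst (X (0, x))))
    (Blinfun (\<lambda>x. snd (X (x, 0)))) (Blinfun (\<lambda>x. snd (X (0, x))))"
  proof (rule block_eqI)
    fix x y
    have "X (x, y) = X (x, 0) + X (0, y)"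
      by (simp flip: blinfun.add_right)
    then show "X (x, y) = (Blinfun (\<lambda>x. fst (X (x, 0))) x + Blinfun (\<lambda>x. fst (X (0, x))) y,
        Blinfun (\<lambda>x. snd (X (x, 0))) x + Blinfun (\<lambda>x. snd (X (0, x))) y)"
      by (simp add: bl bounded_linear_Blinfun_apply prod_eq_iff)
  qed
  then show ?thesis by (rule that)
qed

lemma block_zero: "block 0 0 0 0 = 0"
  by (rule block_eqI[symmetric]) (simp add: zero_prod_def)

lemma block_add:
  "block P Q R T + block P' Q' R' T' = block (P + P') (Q + Q') (R + R') (T + T')"
  by (rule block_eqI) (simp add: blinfun.bilinear_simps block_apply)

lemma block_scaleR: "r *\<^sub>R block P Q R T = block (r *\<^sub>R P) (r *\<^sub>R Q) (r *\<^sub>R R) (r *\<^sub>R T)"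
  by (rule block_eqI) (simp add: blinfun.bilinear_simps block_apply scaleR_add_right)

lemma comm_block:
  "comm (block P Q R T) (block P' Q' R' T') =
    block ((P o\<^sub>L P') + (Q o\<^sub>L R') - ((P' o\<^sub>L P) + (Q' o\<^sub>L R)))
          ((P o\<^sub>L Q') + (Q o\<^sub>L T') - ((P' o\<^sub>L Q) + (Q' o\<^sub>L T)))
          ((R o\<^sub>L P') + (T o\<^sub>L R') - ((R' o\<^sub>L P) + (T' o\<^sub>L R)))
          ((R o\<^sub>L Q') + (T o\<^sub>L T') - ((R' o\<^sub>L Q) + (T' o\<^sub>L T)))"
  by (rule block_eqI) (simp add: comm_def blinfun.bilinear_simps block_apply)

lemma strictly_upper_block_commutes_iff:
  "comm (block 0 N 0 0) (block P Q R T) = 0 \<longleftrightarrow>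
    N o\<^sub>L R = 0 \<and> N o\<^sub>L T = P o\<^sub>L N \<and> R o\<^sub>L N = 0"
  by (auto simp: comm_block block_eq_iff simp flip: block_zero)

lemma upper_triangular_comm:
  "comm (block P Q 0 T) (block P' Q' 0 T') =
    block (comm P P') (((P o\<^sub>L Q') - (Q' o\<^sub>L T)) - ((P' o\<^sub>L Q) - (Q o\<^sub>L T'))) 0 (comm T T')"
  by (simp add: comm_block block_eq_iff) (simp add: comm_def algebra_simps)


section \<open>Conjugation in the Schur algebra\<close>

lemma clifford_square:
  assumes "clifford_module ip c"
  shows "c v (c v x) = (v \<bullet> v) *\<^sub>R x"
proof -
  have "c v o\<^sub>L c v = (v \<bullet> v) *\<^sub>R id_blinfun"
    using assms by (simp add: clifford_module_def ip_def)
  from arg_cong[OF this, of "\<lambda>F. blinfun_apply F x"] show ?thesis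
    by (simp add: blinfun.bilinear_simps)
qed

lemma clifford_unit_square:
  assumes "clifford_module ip c" and "u \<in> Basis"
  shows "c u (c u x) = x"
  using clifford_square[OF assms(1), of u x] assms(2) by simp

lemma clifford_zero: "clifford_module g c \<Longrightarrow> c 0 = 0"
  by (auto simp: clifford_module_def intro: linear_0)

text \<open>
  On the part of \<open>C\<close> that commutes with vectors the relation forces \<open>T = C\<close>, on the anticommuting part
  \<open>T = - C\<close>. That \<open>C\<close> has such a splitting follows from the relation: multiplying \<open>c v T = C c v\<close> by \<open>c v\<close>
  on both sides shows that \<open>C\<close> and \<open>T\<close> may be exchanged in it, so \<open>C\<close> commutes with all \<open>c v c w\<close>.
\<close>

lemma clifford_intertwiner_iff:
  fixes c :: "'e::euclidean_space \<Rightarrow> ('s::euclidean_space \<Rightarrow>\<^sub>L 's)"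
  assumes c: "clifford_module ip c"
  shows "(\<forall>v. c v o\<^sub>L T = C o\<^sub>L c v) \<longleftrightarrow> C \<in> schur_algebra c \<and> T = schur_bar c C"
proof
  assume "C \<in> schur_algebra c \<and> T = schur_bar c C"
  then obtain P M where P: "P \<in> schur_plus c" and M: "M \<in> schur_minus c"
    and C: "C = P + M" and T: "T = schur_bar c C"
    using schur_decomposition[OF c] by blast
  have "T = P - M"
    using schur_bar_eq[OF c P M] C T by simp
  moreover have "P o\<^sub>L c v = c v o\<^sub>L P" "M o\<^sub>L c v = - (c v o\<^sub>L M)" for v
    using P M by (auto simp: schur_plus_def schur_minus_def)
  ultimately show "\<forall>v. c v o\<^sub>L T = C o\<^sub>L c v"
    by (simp add: C compose_linear)
next
  assume rel: "\<forall>v. c v o\<^sub>L T = C o\<^sub>L c v"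
  have TC: "c v (T x) = C (c v x)" for v x
    by (metis rel blinfun_apply_blinfun_compose)
  have CT: "T (c v x) = c v (C x)" for v x
  proof (cases "v = 0")
    case True
    then show ?thesis by (simp add: clifford_zero[OF c])
  next
    case False
    have "(v \<bullet> v) *\<^sub>R T (c v x) = c v (c v (T (c v x)))"
      by (simp add: clifford_square[OF c])
    also have "\<dots> = (v \<bullet> v) *\<^sub>R c v (C x)"
      by (simp add: TC clifford_square[OF c] blinfun.bilinear_simps)
    finally show ?thesis using False by simp
  qed
  have C: "C \<in> schur_algebra c"
    by (auto simp: schur_algebra_def comm_def spin_action_def blinfun.bilinear_simps
        TC[symmetric] CT intro!: blinfun_eqI)
  then obtain P M where P: "P \<in> schur_plus c" and M: "M \<in> schur_minus c" and C_eq: "C = P + M"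
    using schur_decomposition[OF c] by blast
  obtain u :: 'e where u: "u \<in> Basis"
    using nonempty_Basis by blast
  have "T = P - M"
  proof (rule blinfun_eqI)
    fix x
    have "P o\<^sub>L c u = c u o\<^sub>L P" "M o\<^sub>L c u = - (c u o\<^sub>L M)"
      using P M by (auto simp: schur_plus_def schur_minus_def)
    then have "P (c u x) = c u (P x)" "M (c u x) = - c u (M x)"
      by (metis blinfun_apply_blinfun_compose,
          metis blinfun_apply_blinfun_compose uminus_blinfun.rep_eq)
    then have "c u (T x) = c u ((P - M) x)"
      by (simp add: TC C_eq blinfun.bilinear_simps)
    then show "T x = (P - M) x"
      by (metis clifford_unit_square[OF c u])
  qed
  then show "C \<in> schur_algebra c \<and> T = schur_bar c C"
    using C schur_bar_eq[OF c P M] C_eq by simp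
qed

text \<open>
  A formula for the conjugate that is linear and, as unit vectors square to the identity,
  multiplicative in \<open>C\<close>.
\<close>

lemma schur_bar_conjugation:
  fixes c :: "'e::euclidean_space \<Rightarrow> ('s::euclidean_space \<Rightarrow>\<^sub>L 's)"
  assumes c: "clifford_module ip c" and u: "u \<in> Basis" and C: "C \<in> schur_algebra c"
  shows "schur_bar c C = c u o\<^sub>L C o\<^sub>L c u"
proof (rule blinfun_eqI)
  fix x
  have "c u o\<^sub>L schur_bar c C = C o\<^sub>L c u"
    using clifford_intertwiner_iff[OF c] C by blast
  then have "c u (schur_bar c C x) = C (c u x)"
    by (metis blinfun_apply_blinfun_compose)
  then show "schur_bar c C x = (c u o\<^sub>L C o\<^sub>L c u) x"
    by (metis clifford_unit_square[OF c u] blinfun_apply_blinfun_compose)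
qed

lemma linear_schur_bar:
  fixes c :: "'e::euclidean_space \<Rightarrow> ('s::euclidean_space \<Rightarrow>\<^sub>L 's)"
  assumes c: "clifford_module ip c" and f: "linear f" and S: "range f \<subseteq> schur_algebra c"
  shows "linear (\<lambda>x. schur_bar c (f x))"
proof -
  obtain u :: 'e where u: "u \<in> Basis"
    using nonempty_Basis by blast
  have "schur_bar c (f x) = c u o\<^sub>L f x o\<^sub>L c u" for x
    using schur_bar_conjugation[OF c u] S by blast
  then show ?thesis
    by (auto intro!: linearI simp: linear_add[OF f] linear_scale[OF f] compose_linear)
qed

lemma comm_schur_bar:
  fixes c :: "'e::euclidean_space \<Rightarrow> ('s::euclidean_space \<Rightarrow>\<^sub>L 's)"
  assumes c: "clifford_module ip c" and "C \<in> schur_algebra c" "D \<in> schur_algebra c"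
    and CD: "comm C D = 0"
  shows "comm (schur_bar c C) (schur_bar c D) = 0"
proof (rule blinfun_eqI)
  fix x
  obtain u :: 'e where u: "u \<in> Basis"
    using nonempty_Basis by blast
  have "C (D y) = D (C y)" for y
    using arg_cong[OF CD, of "\<lambda>F. blinfun_apply F y"] by (simp add: comm_def blinfun.bilinear_simps)
  then show "comm (schur_bar c C) (schur_bar c D) x = blinfun_apply 0 x"
    using assms
    by (simp add: comm_def blinfun.bilinear_simps schur_bar_conjugation[OF c u]
        clifford_unit_square[OF c u])
qed


section \<open>Coordinates on the Heisenberg algebra\<close>

lemma flat_add: "flat (e + f) = flat e + flat f"
  by (rule blinfun_eqI) (simp add: flat_apply ip_def blinfun.bilinear_simps inner_add_left)

lemma flat_scaleR: "flat (r *\<^sub>R e) = r *\<^sub>R flat e"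
  by (rule blinfun_eqI) (simp add: flat_apply ip_def blinfun.bilinear_simps)

lemma flat_sharp: "flat (sharp \<alpha>) = \<alpha>"
proof -
  \<comment> \<open>The Riesz representative of \<open>\<alpha>\<close>, negated because \<open>ip\<close> is negative definite.\<close>
  have "flat (- (\<Sum>i\<in>Basis. \<alpha> i *\<^sub>R i)) = \<alpha>"
  proof (rule blinfun_eqI)
    fix x
    have "\<alpha> x = \<alpha> (\<Sum>i\<in>Basis. (x \<bullet> i) *\<^sub>R i)"
      by (simp add: euclidean_representation)
    then show "flat (- (\<Sum>i\<in>Basis. \<alpha> i *\<^sub>R i)) x = \<alpha> x"
      by (simp add: flat_apply ip_def inner_sum_left inner_sum_right
          blinfun.sum_right blinfun.scaleR_right inner_commute mult.commute)
  qed
  then show ?thesis by (metis sharp_flat)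
qed

lemma linear_sharp: "linear sharp"
  by (rule linearI) (simp_all add: flat_sharp flat_add flat_scaleR flip: flat_inject)

lemma heis_decomposition:
  "(\<alpha>, e, t) = heis_flat (sharp \<alpha>) + heis_E e + t *\<^sub>R heis_p"
  by (simp add: heis_flat_def heis_E_def heis_p_def flat_sharp)

lemma heis_bracket_eq:
  "heis_bracket b (\<alpha>, e, s) (\<beta>, f, t) = (b (sharp \<alpha>) f - b (sharp \<beta>) e) *\<^sub>R heis_p"
  by (simp add: heis_bracket_def heis_p_def)

lemma linear_heis_E: "linear heis_E"
  by (rule linearI) (simp_all add: heis_E_def)

lemma sharp_zero: "sharp 0 = 0"
  by (rule linear_0[OF linear_sharp])

lemma heis_bracket_E_E:
  assumes "bilinear b"
  shows "heis_bracket b (heis_E e) (heis_E f) = 0"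
  by (simp add: heis_E_def heis_bracket_def sharp_zero bilinear_lzero[OF assms] zero_prod_def)


section \<open>Representations and suitable pairs\<close>

definition pair_map ::
  "('e::euclidean_space \<Rightarrow> ('s::euclidean_space \<Rightarrow>\<^sub>L 's)) \<Rightarrow> ('e \<Rightarrow> 'e) \<Rightarrow>
   ('e \<Rightarrow> ('s \<Rightarrow>\<^sub>L 's)) \<Rightarrow> ('e \<Rightarrow> ('s \<Rightarrow>\<^sub>L 's)) \<Rightarrow> 'e heis \<Rightarrow> (('s \<times> 's) \<Rightarrow>\<^sub>L ('s \<times> 's))"
  where "pair_map c B \<rho>11 \<rho>12 = (\<lambda>(\<alpha>, e, t).
    block (\<rho>11 e) (sqrt 2 *\<^sub>R c (B (sharp \<alpha>)) + \<rho>12 e) 0 (schur_bar c (\<rho>11 e)))"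

text \<open>
  The elements \<open>flat e\<close>, \<open>e\<close> and \<open>p\<close> span the Heisenberg algebra, so the prescribed blocks determine
  the map; conversely, the formula is linear because conjugation is linear on the Schur algebra.
\<close>

lemma given_by_pair_iff:
  fixes c :: "'e::euclidean_space \<Rightarrow> ('s::euclidean_space \<Rightarrow>\<^sub>L 's)"
  assumes c: "clifford_module ip c" and B: "linear B"
    and r11: "linear \<rho>11" "range \<rho>11 \<subseteq> schur_algebra c" and r12: "linear \<rho>12"
  shows "given_by_pair c B \<rho>11 \<rho>12 \<rho> \<longleftrightarrow> \<rho> = pair_map c B \<rho>11 \<rho>12"
proof
  assume g: "given_by_pair c B \<rho>11 \<rho>12 \<rho>"
  then have lin: "linear \<rho>" by (simp add: given_by_pair_def)
  show "\<rho> = pair_map c B \<rho>11 \<rho>12"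
  proof (rule ext, clarify)
    fix \<alpha> e t
    have "\<rho> (\<alpha>, e, t) = \<rho> (heis_flat (sharp \<alpha>) + heis_E e + t *\<^sub>R heis_p)"
      by (rule arg_cong[OF heis_decomposition])
    also have "\<dots> = pair_map c B \<rho>11 \<rho>12 (\<alpha>, e, t)"
      using g
      by (simp add: linear_add[OF lin] linear_scale[OF lin] given_by_pair_def block_add block_zero
          pair_map_def)
    finally show "\<rho> (\<alpha>, e, t) = pair_map c B \<rho>11 \<rho>12 (\<alpha>, e, t)" .
  qed
next
  assume \<rho>: "\<rho> = pair_map c B \<rho>11 \<rho>12"
  have lc: "linear c" using c by (simp add: clifford_module_def)
  note bar = linear_schur_bar[OF c r11]
  have bar_simps: "schur_bar c (\<rho>11 e + \<rho>11 f) = schur_bar c (\<rho>11 e) + schur_bar c (\<rho>11 f)"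
    "schur_bar c (r *\<^sub>R \<rho>11 e) = r *\<^sub>R schur_bar c (\<rho>11 e)" "schur_bar c 0 = 0" for e f r
    using linear_add[OF bar] linear_scale[OF bar] linear_0[OF bar]
    by (simp_all add: linear_add[OF r11(1)] linear_scale[OF r11(1)] linear_0[OF r11(1)])
  have "linear (pair_map c B \<rho>11 \<rho>12)"
    by (rule linearI)
      (auto simp: pair_map_def block_add block_scaleR block_eq_iff linear_add[OF lc]
        linear_add[OF B] linear_add[OF linear_sharp] linear_add[OF r11(1)] linear_add[OF r12]
        bar_simps linear_scale[OF lc] linear_scale[OF B] linear_scale[OF linear_sharp]
        linear_scale[OF r11(1)] linear_scale[OF r12] scaleR_add_right
        mult.commute)
  then show "given_by_pair c B \<rho>11 \<rho>12 \<rho>"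
    by (simp add: \<rho> given_by_pair_def pair_map_def heis_flat_def heis_E_def heis_p_def sharp_flat
        sharp_zero linear_0[OF lc] linear_0[OF B] linear_0[OF r11(1)] linear_0[OF r12]
        bar_simps)
qed

text \<open>
  Every bracket is a multiple of \<open>p\<close>, hence acts by zero, so the images have to commute. The
  off-diagonal entry of the commutator has a part from the suitable pair, which cancels by symmetry,
  and a part from the Clifford multiplications, which cancels by the intertwining relation.
\<close>

lemma pair_map_representation:
  fixes c :: "'e::euclidean_space \<Rightarrow> ('s::euclidean_space \<Rightarrow>\<^sub>L 's)"
  assumes c: "clifford_module ip c" and B: "linear B" and suit: "suitable c \<rho>11 \<rho>12"
  shows "heis_representation b (pair_map c B \<rho>11 \<rho>12)"
proof -
  let ?\<rho> = "pair_map c B \<rho>11 \<rho>12"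
  have r11: "linear \<rho>11" "range \<rho>11 \<subseteq> schur_algebra c" and r12: "linear \<rho>12"
    and comm0: "comm (\<rho>11 e) (\<rho>11 f) = 0"
    and sym: "(\<rho>11 e o\<^sub>L \<rho>12 f) - (\<rho>12 f o\<^sub>L schur_bar c (\<rho>11 e)) =
           (\<rho>11 f o\<^sub>L \<rho>12 e) - (\<rho>12 e o\<^sub>L schur_bar c (\<rho>11 f))" for e f
    using suit by (auto simp: suitable_def)
  have given: "given_by_pair c B \<rho>11 \<rho>12 ?\<rho>"
    using given_by_pair_iff[OF c B r11 r12] by simp
  then have lin: "linear ?\<rho>" and p: "?\<rho> heis_p = 0"
    by (simp_all add: given_by_pair_def block_zero)
  have inter: "c v o\<^sub>L schur_bar c (\<rho>11 e) = \<rho>11 e o\<^sub>L c v" for v e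
    using clifford_intertwiner_iff[OF c] r11(2) by blast
  have comm_bar: "comm (schur_bar c (\<rho>11 e)) (schur_bar c (\<rho>11 f)) = 0" for e f
    using comm_schur_bar[OF c _ _ comm0] r11(2) by blast
  have "comm (?\<rho> x) (?\<rho> y) = 0" for x y
  proof -
    obtain \<alpha> e s \<beta> f t where xy: "x = (\<alpha>, e, s)" "y = (\<beta>, f, t)"
      by (metis prod.exhaust)
    have "(\<rho>11 e o\<^sub>L (sqrt 2 *\<^sub>R c v + \<rho>12 f)) - ((sqrt 2 *\<^sub>R c v + \<rho>12 f) o\<^sub>L schur_bar c (\<rho>11 e)) =
        (\<rho>11 e o\<^sub>L \<rho>12 f) - (\<rho>12 f o\<^sub>L schur_bar c (\<rho>11 e))" for v e f
      by (simp add: compose_linear inter)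
    then show ?thesis
      by (simp add: xy pair_map_def upper_triangular_comm comm0 comm_bar sym[of e f] block_zero)
  qed
  moreover have "?\<rho> (heis_bracket b x y) = 0" for x y
    by (cases x; cases y) (simp add: heis_bracket_eq linear_scale[OF lin] p)
  ultimately show ?thesis
    using lin by (simp add: heis_representation_def)
qed

text \<open>
  The pair is read off from the blocks of \<open>\<rho>\<close> on \<open>E\<close>. Surjectivity of \<open>B\<close> turns commutation with the
  images of the \<open>flat e\<close> into relations with Clifford multiplication by all vectors; these kill the
  lower left block and make the lower right block the conjugate of the upper left one.
\<close>

lemma zero_charge_representation_given_by_pair:
  fixes c :: "'e::euclidean_space \<Rightarrow> ('s::euclidean_space \<Rightarrow>\<^sub>L 's)"
  assumes c: "clifford_module ip c" and b: "bilinear b" and B: "surj B"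
    and rep: "heis_representation b \<rho>" and charge: "zero_charge \<rho>"
    and flat: "\<And>e. \<rho> (heis_flat e) = block 0 (sqrt 2 *\<^sub>R c (B e)) 0 0"
  shows "\<exists>\<rho>11 \<rho>12. suitable c \<rho>11 \<rho>12 \<and> given_by_pair c B \<rho>11 \<rho>12 \<rho>"
proof -
  have lin: "linear \<rho>" and p: "\<rho> heis_p = 0"
    and br: "\<rho> (heis_bracket b x y) = comm (\<rho> x) (\<rho> y)" for x y
    using rep charge unfolding heis_representation_def zero_charge_def by blast+
  have "\<forall>e. \<exists>P Q R T. \<rho> (heis_E e) = block P Q R T"
    by (metis block_exhaust)
  then obtain P Q R T where PQRT: "\<And>e. \<rho> (heis_E e) = block (P e) (Q e) (R e) (T e)"
    by metis
  have "linear (\<lambda>e. \<rho> (heis_E e))"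
    using linear_compose[OF linear_heis_E lin] by (simp add: o_def)
  from linear_add[OF this] linear_scale[OF this]
  have linP: "linear P" and linQ: "linear Q"
    by (auto intro!: linearI simp: PQRT block_add block_scaleR block_eq_iff)
  have "comm (\<rho> (heis_flat e)) (\<rho> (heis_E f)) = 0" for e f
    using br[of "heis_flat e" "heis_E f"]
    by (simp add: heis_bracket_flat_E[OF b] linear_scale[OF lin] p)
  then have rel: "c (B e) o\<^sub>L R f = 0" "c (B e) o\<^sub>L T f = P f o\<^sub>L c (B e)" for e f
    by (simp_all add: flat PQRT strictly_upper_block_commutes_iff compose_linear)
  have R: "R f = 0" for f
  proof (rule blinfun_eqI)
    fix x
    obtain u :: 'e where u: "u \<in> Basis"
      using nonempty_Basis by blast
    obtain e where "B e = u"
      using B by (metis surjD)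
    then have "c u (R f x) = 0"
      using arg_cong[OF rel(1)[of e f], of "\<lambda>F. blinfun_apply F x"] by simp
    then show "R f x = blinfun_apply 0 x"
      using clifford_unit_square[OF c u, of "R f x"] by simp
  qed
  have "c v o\<^sub>L T f = P f o\<^sub>L c v" for v f
    using rel(2)[of _ f] B by (metis surjD)
  then have P: "P f \<in> schur_algebra c" and T: "T f = schur_bar c (P f)" for f
    using clifford_intertwiner_iff[OF c] by blast+
  have "comm (\<rho> (heis_E e)) (\<rho> (heis_E f)) = 0" for e f
    using br[of "heis_E e" "heis_E f"] by (simp add: heis_bracket_E_E[OF b] linear_0[OF lin])
  then have "comm (P e) (P f) = 0"
    "(P e o\<^sub>L Q f) - (Q f o\<^sub>L T e) = (P f o\<^sub>L Q e) - (Q e o\<^sub>L T f)" for e f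
    by (simp_all add: PQRT R upper_triangular_comm block_eq_iff flip: block_zero)
  then have "suitable c P Q"
    using linP linQ P by (auto simp: suitable_def T)
  moreover have "given_by_pair c B P Q \<rho>"
    by (simp add: given_by_pair_def lin flat p PQRT R T block_zero)
  ultimately show ?thesis by blast
qed

theorem theorem2p3:
  fixes n :: nat
    and b :: "'e::euclidean_space \<Rightarrow> 'e \<Rightarrow> real"
    and B :: "'e \<Rightarrow> 'e"
    and \<gamma> :: "'e \<Rightarrow> ('s::euclidean_space \<Rightarrow>\<^sub>L 's)"
    and \<Gamma> :: "'e \<times> real \<times> real \<Rightarrow> (('s \<times> 's) \<Rightarrow>\<^sub>L ('s \<times> 's))"
  assumes "n \<ge> 2" and "DIM('e) = n - 1"
    and "bilinear b" and "\<And>e f. b e f = b f e" and "\<And>e. (\<forall>f. b e f = 0) \<Longrightarrow> e = 0"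
    and "linear B" and "\<And>e f. b e f = - ip (B e) f"
    and "irreducible_clifford_module ip \<gamma>"
    and "irreducible_clifford_module mink_ip \<Gamma>"
    and "\<And>e. spin_action \<Gamma> mink_p (mink_E e) = block 0 (sqrt 2 *\<^sub>R \<gamma> e) 0 0"
  shows "(\<forall>\<rho>11 \<rho>12. suitable \<gamma> \<rho>11 \<rho>12 \<longrightarrow>
           (\<exists>!\<rho>. given_by_pair \<gamma> B \<rho>11 \<rho>12 \<rho>) \<and>
           (\<forall>\<rho>. given_by_pair \<gamma> B \<rho>11 \<rho>12 \<rho> \<longrightarrow> spin_representation b B \<Gamma> \<rho> \<and> zero_charge \<rho>)) \<and>
         (\<forall>\<rho>. spin_representation b B \<Gamma> \<rho> \<and> zero_charge \<rho> \<longrightarrow>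
           (\<exists>\<rho>11 \<rho>12. suitable \<gamma> \<rho>11 \<rho>12 \<and> given_by_pair \<gamma> B \<rho>11 \<rho>12 \<rho>))"
proof -
  have c: "clifford_module ip \<gamma>"
    using assms(8) by (simp add: irreducible_clifford_module_def)
  note B = \<open>linear B\<close>
  have "inj B"
    unfolding linear_injective_0[OF B]
    using assms(5,7) by (simp add: ip_def)
  then have surj: "surj B"
    using linear_injective_imp_surjective[OF B] by blast
  have spin: "spin_representation b B \<Gamma> \<rho> \<longleftrightarrow> heis_representation b \<rho> \<and>
      (\<forall>e. \<rho> (heis_flat e) = block 0 (sqrt 2 *\<^sub>R \<gamma> (B e)) 0 0)" for \<rho>
    by (simp add: spin_representation_def assms(10))
  show ?thesis
  proof (intro conjI allI impI)
    fix \<rho>11 \<rho>12 assume suit: "suitable \<gamma> \<rho>11 \<rho>12"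
    then have iff: "given_by_pair \<gamma> B \<rho>11 \<rho>12 \<rho> \<longleftrightarrow> \<rho> = pair_map \<gamma> B \<rho>11 \<rho>12" for \<rho>
      by (intro given_by_pair_iff[OF c B]) (auto simp: suitable_def)
    then show "\<exists>!\<rho>. given_by_pair \<gamma> B \<rho>11 \<rho>12 \<rho>"
      by simp
    fix \<rho> assume given: "given_by_pair \<gamma> B \<rho>11 \<rho>12 \<rho>"
    then have "heis_representation b \<rho>"
      using pair_map_representation[OF c B suit] iff by simp
    then show "spin_representation b B \<Gamma> \<rho>"
      using given by (simp add: spin given_by_pair_def)
    show "zero_charge \<rho>"
      using given by (simp add: zero_charge_def given_by_pair_def block_zero)
  next
    fix \<rho> assume "spin_representation b B \<Gamma> \<rho> \<and> zero_charge \<rho>"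
    then show "\<exists>\<rho>11 \<rho>12. suitable \<gamma> \<rho>11 \<rho>12 \<and> given_by_pair \<gamma> B \<rho>11 \<rho>12 \<rho>"
      using zero_charge_representation_given_by_pair[OF c assms(3) surj] by (simp add: spin)
  qed
qed

end
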